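(* Let $p\equiv 1\pmod 4$ be a prime and $r\geq 1$ an integer. Then $$ \sum_{k=0}^{p^r-1}\left(k-\frac{p^{2r}-1}{4}\right)\frac{\left(\frac12\right)_k^2}{k!^2}\equiv 0\pmod{p^{2r+1}}. $$
   Context: $(x)_k=x(x+1)\cdots(x+k-1)$ denotes the Pochhammer symbol, with $(x)_0=1$. The congruence is understood in the ring $\mathbb{Z}_p$ of $p$-adic integers (the summands are rationals with denominators prime to $p$). *)

theory Defs
  imports Complex_Main "HOL-Number_Theory.Number_Theory"
begin

text \<open>
  The rationals that are \<open>p\<close>-adic integers, i.e. the intersection of \<open>\<rat>\<close> with the ring
  \<open>\<int>\<^sub>p\<close> (for prime \<open>p\<close>). Note that \<^const>\<open>quotient_of\<close> returns the fraction in lowest terms.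
\<close>

definition padic_integral :: "nat \<Rightarrow> rat set" where
  "padic_integral p = {x. coprime (snd (quotient_of x)) (int p)}"

text \<open>
  Congruence in \<open>\<int>\<^sub>p\<close> restricted to rational elements and a rational modulus. For rational
  \<open>x\<close>, \<open>y\<close> and \<open>m \<noteq> 0\<close>, a quotient \<open>(x - y) / m\<close> lying in \<open>\<int>\<^sub>p\<close> is itself rational, so it
  suffices to let the cofactor range over \<open>\<rat> \<inter> \<int>\<^sub>p\<close>.
\<close>

definition padic_cong :: "nat \<Rightarrow> rat \<Rightarrow> rat \<Rightarrow> rat \<Rightarrow> bool" where
  "padic_cong p x y m \<longleftrightarrow>
     x \<in> padic_integral p \<and> y \<in> padic_integral p \<and> (\<exists>z\<in>padic_integral p. x - y = m * z)"

end

theory Submission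
  imports Defs
begin

text \<open>
  Write \<open>u\<^sub>k = (1/2)\<^sub>k\<^sup>2 / k!\<^sup>2 = (binom(2k, k) / 4\<^sup>k)\<^sup>2\<close> and \<open>n = p\<^sup>r\<close>.
  Since \<open>(k+1)\<^sup>2 u\<^sub>k\<^sub>+\<^sub>1 - k\<^sup>2 u\<^sub>k = (k + 1/4) u\<^sub>k\<close>, the sum equals
  \<open>n\<^sup>2 (u\<^sub>n - (\<Sum>k<n. u\<^sub>k) / 4)\<close>, and it suffices to work modulo \<open>p\<close>. There
  \<open>u\<^sub>n \<equiv> 1/4\<close>, because \<open>binom(2n, n) \<equiv> 2\<close> and \<open>4\<^sup>n \<equiv> 4\<close>. Moreover
  \<open>binom(2k, k) / (-4)\<^sup>k = binom(-1/2, k) \<equiv> binom(m, k)\<close> for \<open>k < n\<close> and \<open>m = (n - 1) / 2\<close>, so that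
  \<open>\<Sum>k<n. u\<^sub>k \<equiv> \<Sum>k. binom(m, k)\<^sup>2 = binom(n - 1, m) \<equiv> (-1)\<^sup>m = 1\<close>.
\<close>

section \<open>Congruences between rationals\<close>

text \<open>The denominator in lowest terms divides the denominator of any other representation. So
  any fraction with denominator prime to \<open>p\<close> is a certificate, and closure proofs need
  not mention \<open>quotient_of\<close>.\<close>

lemma padic_integral_iff:
  "x \<in> padic_integral p \<longleftrightarrow> (\<exists>a b. b \<noteq> 0 \<and> coprime b (int p) \<and> x = of_int a / of_int b)"
proof
  assume x: "x \<in> padic_integral p"
  obtain a b where ab: "quotient_of x = (a, b)" by force
  show "\<exists>a b. b \<noteq> 0 \<and> coprime b (int p) \<and> x = of_int a / of_int b"
    using x ab quotient_of_div[OF ab] quotient_of_denom_pos[OF ab]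
    by (intro exI[of _ a] exI[of _ b]) (auto simp: padic_integral_def)
next
  assume "\<exists>a b. b \<noteq> 0 \<and> coprime b (int p) \<and> x = of_int a / of_int b"
  then obtain a b where ab: "b \<noteq> 0" "coprime b (int p)" "x = of_int a / of_int b" by blast
  obtain c d where cd: "quotient_of x = (c, d)" by force
  have x: "x = of_int c / of_int d" and d: "d > 0" and cop: "coprime c d"
    using cd quotient_of_div quotient_of_denom_pos quotient_of_coprime by auto
  have "(of_int (a * d) :: rat) = of_int (c * b)"
    using x ab d by (simp add: field_simps)
  then have "a * d = c * b" by (simp only: of_int_eq_iff)
  then have "d dvd c * b" by (metis dvd_triv_right)
  then have "d dvd b" using cop by (simp add: coprime_commute coprime_dvd_mult_right_iff)
  then have "coprime d (int p)" using ab(2) coprime_divisors[of d b "int p" "int p"] by simp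
  then show "x \<in> padic_integral p" by (simp add: padic_integral_def cd)
qed

lemma padic_integral_of_int [simp]: "of_int a \<in> padic_integral p"
  by (simp add: padic_integral_def)

lemma padic_integral_of_nat [simp]: "of_nat a \<in> padic_integral p"
  by (simp add: padic_integral_def)

lemma padic_integral_0 [simp]: "0 \<in> padic_integral p"
  and padic_integral_1 [simp]: "1 \<in> padic_integral p"
  by (simp_all add: padic_integral_def)

lemma padic_integral_mult:
  assumes "x \<in> padic_integral p" "y \<in> padic_integral p"
  shows "x * y \<in> padic_integral p"
proof -
  from assms obtain a b c d where "b \<noteq> 0" "coprime b (int p)" "x = of_int a / of_int b"
    "d \<noteq> 0" "coprime d (int p)" "y = of_int c / of_int d"
    by (auto simp: padic_integral_iff)
  then show ?thesis unfolding padic_integral_iff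
    by (intro exI[of _ "a * c"] exI[of _ "b * d"]) simp
qed

lemma padic_integral_add:
  assumes "x \<in> padic_integral p" "y \<in> padic_integral p"
  shows "x + y \<in> padic_integral p"
proof -
  from assms obtain a b c d where "b \<noteq> 0" "coprime b (int p)" "x = of_int a / of_int b"
    "d \<noteq> 0" "coprime d (int p)" "y = of_int c / of_int d"
    by (auto simp: padic_integral_iff)
  then show ?thesis unfolding padic_integral_iff
    by (intro exI[of _ "a * d + c * b"] exI[of _ "b * d"]) (simp add: add_frac_eq)
qed

lemma padic_integral_uminus: "x \<in> padic_integral p \<Longrightarrow> - x \<in> padic_integral p"
  using padic_integral_mult[of "of_int (- 1)" p x] padic_integral_of_int[of "- 1" p] by simp

lemma padic_integral_diff:
  "x \<in> padic_integral p \<Longrightarrow> y \<in> padic_integral p \<Longrightarrow> x - y \<in> padic_integral p"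
  using padic_integral_add[of x p "- y"] padic_integral_uminus[of y p] by simp

lemma padic_integral_inverse_of_nat:
  assumes "coprime a p" "a \<noteq> 0"
  shows "inverse (of_nat a) \<in> padic_integral p"
  unfolding padic_integral_iff using assms
  by (intro exI[of _ 1] exI[of _ "int a"]) (simp add: field_simps)

section \<open>Compatibility of the congruence with ring operations\<close>

lemma padic_congI:
  "x \<in> padic_integral p \<Longrightarrow> y \<in> padic_integral p \<Longrightarrow> z \<in> padic_integral p \<Longrightarrow> x - y = m * z
    \<Longrightarrow> padic_cong p x y m"
  unfolding padic_cong_def by blast

lemma padic_congE:
  assumes "padic_cong p x y m"
  obtains z where "x \<in> padic_integral p" "y \<in> padic_integral p" "z \<in> padic_integral p"
    "x = y + m * z"
proof -
  from assms obtain z where z: "x \<in> padic_integral p" "y \<in> padic_integral p"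
    "z \<in> padic_integral p" "x - y = m * z"
    unfolding padic_cong_def by blast
  from z(4) have "x = y + m * z" by (simp add: diff_eq_eq add.commute)
  with z(1-3) show thesis by (rule that)
qed

lemma padic_cong_refl: "x \<in> padic_integral p \<Longrightarrow> padic_cong p x x m"
  by (rule padic_congI[of _ _ _ 0]) simp_all

lemma padic_cong_sym:
  assumes "padic_cong p x y m"
  shows "padic_cong p y x m"
  using assms
proof (rule padic_congE)
  fix s assume s: "x \<in> padic_integral p" "y \<in> padic_integral p" "s \<in> padic_integral p"
    "x = y + m * s"
  show ?thesis
  proof (rule padic_congI)
    show "- s \<in> padic_integral p" using s(3) by (rule padic_integral_uminus)
    show "y - x = m * - s" unfolding s(4) by simp
  qed fact+
qed

lemma padic_cong_trans [trans]:
  assumes "padic_cong p x y m" "padic_cong p y z m"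
  shows "padic_cong p x z m"
proof -
  obtain s where s: "x \<in> padic_integral p" "s \<in> padic_integral p" "x = y + m * s"
    using assms(1) by (rule padic_congE)
  obtain t where t: "z \<in> padic_integral p" "t \<in> padic_integral p" "y = z + m * t"
    using assms(2) by (rule padic_congE)
  show ?thesis
  proof (rule padic_congI)
    show "s + t \<in> padic_integral p" using s(2) t(2) by (rule padic_integral_add)
    show "x - z = m * (s + t)" unfolding s(3) t(3) by (simp add: algebra_simps)
  qed fact+
qed

lemma padic_cong_add:
  assumes "padic_cong p x y m" "padic_cong p x' y' m"
  shows "padic_cong p (x + x') (y + y') m"
proof -
  obtain s where s: "x \<in> padic_integral p" "y \<in> padic_integral p" "s \<in> padic_integral p"
    "x = y + m * s"
    using assms(1) by (rule padic_congE)
  obtain t where t: "x' \<in> padic_integral p" "y' \<in> padic_integral p" "t \<in> padic_integral p"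
    "x' = y' + m * t"
    using assms(2) by (rule padic_congE)
  show ?thesis
  proof (rule padic_congI)
    show "s + t \<in> padic_integral p" using s(3) t(3) by (rule padic_integral_add)
    show "x + x' - (y + y') = m * (s + t)" unfolding s(4) t(4) by (simp add: algebra_simps)
  qed (intro padic_integral_add s(1,2) t(1,2))+
qed

lemma padic_cong_mult:
  assumes "padic_cong p x y m" "padic_cong p x' y' m"
  shows "padic_cong p (x * x') (y * y') m"
proof -
  obtain s where s: "x \<in> padic_integral p" "y \<in> padic_integral p" "s \<in> padic_integral p"
    "x = y + m * s"
    using assms(1) by (rule padic_congE)
  obtain t where t: "x' \<in> padic_integral p" "y' \<in> padic_integral p" "t \<in> padic_integral p"
    "x' = y' + m * t"
    using assms(2) by (rule padic_congE)
  show ?thesis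
  proof (rule padic_congI)
    \<comment> \<open>From the splitting
      \<open>x * x' - y * y' = (x - y) * x' + y * (x' - y')\<close>.\<close>
    show "s * x' + y * t \<in> padic_integral p"
      by (intro padic_integral_add padic_integral_mult s t)
    show "x * x' - y * y' = m * (s * x' + y * t)"
      unfolding s(4) t(4) by (simp add: algebra_simps)
  qed (intro padic_integral_mult s(1,2) t(1,2))+
qed

lemma padic_cong_power: "padic_cong p x y m \<Longrightarrow> padic_cong p (x ^ k) (y ^ k) m"
  by (induction k) (auto intro: padic_cong_mult padic_cong_refl)

lemma padic_cong_sum:
  "(\<And>k. k \<in> A \<Longrightarrow> padic_cong p (f k) (g k) m) \<Longrightarrow> padic_cong p (sum f A) (sum g A) m"
  by (induction A rule: infinite_finite_induct) (auto intro: padic_cong_add padic_cong_refl)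

section \<open>Transfer from integer congruences and integrality of quotients\<close>

lemma padic_cong_of_int:
  assumes "[a = b] (mod m)"
  shows "padic_cong p (of_int a) (of_int b) (of_int m)"
proof -
  obtain c where c: "a - b = m * c" using assms by (auto simp: cong_iff_dvd_diff)
  have "(of_int a - of_int b :: rat) = of_int m * of_int c"
    using c by (metis of_int_diff of_int_mult)
  then show ?thesis
    by (rule padic_congI[OF padic_integral_of_int padic_integral_of_int padic_integral_of_int])
qed

lemma padic_cong_of_nat:
  assumes "[a = b] (mod m)"
  shows "padic_cong p (of_nat a) (of_nat b) (of_nat m)"
  using padic_cong_of_int[of "int a" "int b" "int m" p] assms by (simp add: cong_int_iff)

text \<open>Multiply \<open>b\<close> \<equiv> \<open>a\<close> by \<open>1 / (a * b)\<close>, which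
  is p-integral.\<close>

lemma padic_cong_inverse_of_nat:
  assumes "[a = b] (mod m)" "coprime a p" "a \<noteq> 0" "coprime b p" "b \<noteq> 0"
  shows "padic_cong p (inverse (of_nat a)) (inverse (of_nat b)) (of_nat m)"
proof -
  let ?s = "inverse (of_nat a) * inverse (of_nat b) :: rat"
  have "padic_cong p (of_nat b * ?s) (of_nat a * ?s) (of_nat m)"
    using assms
    by (intro padic_cong_mult padic_cong_of_nat padic_cong_refl padic_integral_mult
        padic_integral_inverse_of_nat) (auto simp: cong_sym)
  then show ?thesis using assms by (simp add: field_simps)
qed

text \<open>The bound on \<open>m\<close> keeps its p-adic valuation at most \<open>r\<close>, so
  \<open>p ^ r\<close> cancels the whole p-part of \<open>m\<close>.\<close>

lemma prime_power_div_padic_integral: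
  assumes "prime p" "0 < m" "m < p ^ Suc r"
  shows "of_nat (p ^ r) / of_nat m \<in> padic_integral p"
proof -
  have "\<not> is_unit p" using assms(1) not_prime_unit by blast
  then obtain c where c: "m = p ^ multiplicity p m * c" "\<not> p dvd c"
    using multiplicity_decompose'[of m p] assms(2) by auto
  let ?a = "multiplicity p m"
  have "c \<noteq> 0" using c(2) by (metis dvd_0_right)
  then have "p ^ ?a \<le> m" using c(1) by (metis One_nat_def Suc_leI mult.right_neutral mult_le_mono2 neq0_conv)
  then have "p ^ ?a < p ^ Suc r" using assms(3) by linarith
  then have ar: "?a \<le> r"
    using assms(1) power_strict_increasing_iff[of p ?a "Suc r"] prime_gt_1_nat by simp
  have p: "p \<noteq> 0" using assms(1) by auto
  have "p ^ r = p ^ ?a * p ^ (r - ?a)" using ar by (simp flip: power_add)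
  then have "of_nat (p ^ r) / (of_nat m :: rat) = of_nat (p ^ (r - ?a)) * inverse (of_nat c)"
    using p \<open>c \<noteq> 0\<close> by (subst c(1)) (simp add: field_simps)
  moreover have "coprime c p"
    using prime_imp_coprime[OF assms(1) c(2)] by (simp add: coprime_commute)
  ultimately show ?thesis
    using \<open>c \<noteq> 0\<close> by (metis padic_integral_inverse_of_nat padic_integral_mult padic_integral_of_nat)
qed

section \<open>Binomial coefficients modulo a prime\<close>

text \<open>If \<open>p\<close> did not divide the coefficient, the absorption identity would force
  \<open>p ^ r\<close> to divide \<open>j\<close>, which is positive and too small.\<close>

lemma prime_dvd_choose_prime_power:
  fixes p :: nat
  assumes "prime p" "0 < j" "j < p ^ r"
  shows "p dvd (p ^ r choose j)"
proof (rule ccontr)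
  assume "\<not> p dvd (p ^ r choose j)"
  then have "coprime (p ^ r) (p ^ r choose j)"
    using assms(1) by (simp add: prime_imp_coprime)
  moreover have "j * (p ^ r choose j) = p ^ r * ((p ^ r - 1) choose (j - 1))"
    using assms(2) by (rule times_binomial_minus1_eq)
  then have "p ^ r dvd j * (p ^ r choose j)" by simp
  ultimately have "p ^ r dvd j" by (simp add: coprime_dvd_mult_left_iff)
  then show False using assms by (auto dest: dvd_imp_le)
qed

text \<open>In the Vandermonde expansion only the term \<open>j = 0\<close> survives modulo
  \<open>p\<close>, since \<open>j \<le> k < p ^ r\<close>.\<close>

lemma choose_add_prime_power_cong:
  fixes p :: nat
  assumes "prime p" "k < p ^ r"
  shows "[(p ^ r + x) choose k = x choose k] (mod p)"
proof -
  have "(p ^ r + x) choose k = (\<Sum>j\<le>k. (p ^ r choose j) * (x choose (k - j)))"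
    by (rule vandermonde[symmetric])
  also have "[\<dots> = (\<Sum>j\<le>k. if j = 0 then x choose k else 0)] (mod p)"
  proof (rule cong_sum)
    fix j assume "j \<in> {..k}"
    then show "[(p ^ r choose j) * (x choose (k - j)) = (if j = 0 then x choose k else 0)] (mod p)"
      using prime_dvd_choose_prime_power[of p j r] assms by (auto simp: cong_0_iff)
  qed
  finally show ?thesis by simp
qed

lemma choose_add_mult_prime_power_cong:
  fixes p :: nat
  assumes "prime p" "k < p ^ r"
  shows "[(t * p ^ r + x) choose k = x choose k] (mod p)"
proof (induction t)
  case (Suc t)
  have "[(p ^ r + (t * p ^ r + x)) choose k = (t * p ^ r + x) choose k] (mod p)"
    using assms by (rule choose_add_prime_power_cong)
  with Suc show ?case by (auto simp: add.assoc intro: cong_trans)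
qed simp

text \<open>By Pascal's rule, neighbouring entries of row \<open>p ^ r - 1\<close> add up to an
  inner entry of row \<open>p ^ r\<close>, which is 0 modulo \<open>p\<close>; hence the signs
  alternate from 1.\<close>

lemma choose_prime_power_minus_1_cong:
  fixes p :: nat
  assumes "prime p" "k < p ^ r"
  shows "[int ((p ^ r - 1) choose k) = (- 1) ^ k] (mod int p)"
  using assms(2)
proof (induction k)
  case (Suc k)
  have "Suc (p ^ r - 1) = p ^ r" using Suc.prems by simp
  then have "p ^ r choose Suc k = ((p ^ r - 1) choose k) + ((p ^ r - 1) choose Suc k)"
    by (metis binomial_Suc_Suc)
  moreover have "int p dvd int (p ^ r choose Suc k)"
    using prime_dvd_choose_prime_power[OF assms(1) _ Suc.prems] by simp
  ultimately have "int p dvd int ((p ^ r - 1) choose k) + int ((p ^ r - 1) choose Suc k)"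
    by (metis of_nat_add)
  moreover have "int p dvd int ((p ^ r - 1) choose k) - (- 1) ^ k"
    using Suc by (simp add: cong_iff_dvd_diff)
  ultimately have "int p dvd (int ((p ^ r - 1) choose k) + int ((p ^ r - 1) choose Suc k))
      - (int ((p ^ r - 1) choose k) - (- 1) ^ k)"
    by (rule dvd_diff)
  then show ?case by (simp add: cong_iff_dvd_diff)
qed simp

text \<open>Absorption extracts the factor 2; removing \<open>p ^ r\<close> from the upper index of
  the remaining coefficient leaves \<open>(n - 1) choose (n - 1) = 1\<close>.\<close>

lemma central_choose_prime_power_cong:
  fixes p :: nat
  assumes "prime p"
  shows "[(2 * p ^ r) choose (p ^ r) = 2] (mod p)"
proof -
  define n where "n = p ^ r"
  have n: "n > 0" using assms by (simp add: n_def prime_gt_0_nat)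
  have "2 * n choose n = 2 * ((2 * n - 1) choose (n - 1))"
    using times_binomial_minus1_eq[of n "2 * n"] n by simp
  also have "2 * n - 1 = n + (n - 1)" using n by simp
  also have "[2 * ((n + (n - 1)) choose (n - 1)) = 2 * ((n - 1) choose (n - 1))] (mod p)"
    unfolding n_def
    by (intro cong_mult cong_refl choose_add_prime_power_cong) (use assms n n_def in auto)
  finally show ?thesis by (simp add: n_def)
qed

text \<open>Fermat's little theorem, iterated \<open>r\<close> times.\<close>

lemma power_prime_power_cong:
  fixes a p :: nat
  assumes "prime p" "\<not> p dvd a"
  shows "[a ^ (p ^ r) = a] (mod p)"
proof (induction r)
  case (Suc r)
  have "[a ^ (p - 1) * a = 1 * a] (mod p)"
    using assms by (intro cong_mult fermat_theorem cong_refl)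
  then have p: "[a ^ p = a] (mod p)"
    using power_minus_mult[of p a] prime_gt_0_nat[OF assms(1)] by simp
  have "[(a ^ (p ^ r)) ^ p = a ^ p] (mod p)" using Suc by (rule cong_pow)
  with p show ?case by (auto simp: mult.commute power_mult[symmetric] intro: cong_trans)
qed simp

section \<open>Central binomial coefficients\<close>

text \<open>Both sides come from the duplication formula
  \<open>fact (2 * k) = 4 ^ k * pochhammer (1 / 2) k * fact k\<close>.\<close>

lemma pochhammer_half_over_fact:
  "pochhammer (1 / 2) k / fact k = (of_nat ((2 * k) choose k) / 4 ^ k :: 'a::field_char_0)"
proof -
  have "of_nat ((2 * k) choose k) = (fact (2 * k) / (fact k * fact k) :: 'a)"
    using binomial_fact[of k "2 * k"] by simp
  also have "\<dots> = 4 ^ k * pochhammer (1 / 2) k / fact k"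
    by (simp add: fact_double power_mult)
  finally show ?thesis by simp
qed

text \<open>An exact form of the comparison of binom(m, k) with binom(-1/2, k): since
  \<open>m = (q - 1) / 2\<close>, each factor \<open>- m + i\<close> of the Pochhammer symbol equals
  \<open>(1 / 2 + i) * (1 - q / (2 * i + 1))\<close>. A p-adically small \<open>q\<close> makes the
  correction product close to 1.\<close>

lemma choose_half_eq_central_choose:
  fixes q m k :: nat
  assumes "q = 2 * m + 1"
  shows "of_nat (m choose k) * (- 4) ^ k =
    (of_nat ((2 * k) choose k) * (\<Prod>i<k. 1 - of_nat q / of_nat (2 * i + 1)) :: 'a::field_char_0)"
proof -
  have poch: "of_nat (m choose k) * (- 1) ^ k = (pochhammer (- of_nat m) k / fact k :: 'a)"
    by (simp add: binomial_gbinomial gbinomial_pochhammer flip: power_mult_distrib)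
  have ratio: "pochhammer (- of_nat m) k =
      (pochhammer (1 / 2) k * (\<Prod>i<k. 1 - of_nat q / of_nat (2 * i + 1)) :: 'a)"
  proof (induction k)
    case (Suc k)
    let ?d = "of_nat (2 * k + 1) :: 'a"
    have d: "?d \<noteq> 0" by (metis of_nat_eq_0_iff add_is_0 one_neq_zero)
    have half: "1 / 2 + of_nat k = ?d / 2" by (simp add: field_simps)
    have "d / 2 * (1 - of_nat q / d) = (d - of_nat q) / 2" if "d \<noteq> 0" for d :: 'a
      using that by (simp add: field_simps)
    note this[OF d]
    then have "- of_nat m + of_nat k = ((1 / 2 + of_nat k) * (1 - of_nat q / ?d) :: 'a)"
      unfolding half by (simp add: assms)
    with Suc show ?case by (simp add: pochhammer_Suc)
  qed simp
  have "of_nat (m choose k) * (- 4) ^ k = (of_nat (m choose k) * (- 1) ^ k) * (4 ^ k :: 'a)"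
    by (simp add: mult.assoc flip: power_mult_distrib)
  also have "\<dots> = 4 ^ k * (pochhammer (1 / 2) k / fact k) * (\<Prod>i<k. 1 - of_nat q / of_nat (2 * i + 1))"
    by (simp add: poch ratio)
  also have "\<dots> = of_nat ((2 * k) choose k) * (\<Prod>i<k. 1 - of_nat q / of_nat (2 * i + 1))"
    by (simp add: pochhammer_half_over_fact)
  finally show ?thesis .
qed

text \<open>The exact identity is applied with \<open>q = p * p ^ r\<close>, where each correction
  factor is 1 minus \<open>p\<close> times a p-integral number. The resulting upper index
  \<open>(q - 1) div 2\<close> is then lowered to \<open>(p ^ r - 1) div 2\<close> modulo
  \<open>p\<close>.\<close>

lemma central_choose_padic_cong:
  fixes p r k :: nat
  assumes "prime p" "odd p" "k < p ^ r"
  shows "padic_cong p (of_nat ((2 * k) choose k))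
    (of_nat (((p ^ r - 1) div 2) choose k) * (- 4) ^ k) (of_nat p)"
proof -
  \<comment> \<open>With \<open>p\<^sup>r\<close> in place of \<open>q = p\<^sup>r\<^sup>+\<^sup>1\<close>, the factor with \<open>2i + 1 = p\<^sup>r\<close> would not be \<open>\<equiv> 1\<close>.\<close>
  define n where "n = p ^ r"
  define q where "q = p * n"
  define m where "m = (q - 1) div 2"
  have p3: "p \<ge> 3" using assms(1,2) prime_ge_2_nat[of p] by (cases "p = 2") auto
  have odd_n: "odd n" and odd_q: "odd q" using assms(2) by (auto simp: n_def q_def)
  have qm: "q = 2 * m + 1" using odd_q by (auto simp: m_def elim!: oddE)
  have prod: "padic_cong p (\<Prod>i<j. 1 - of_nat q / of_nat (2 * i + 1)) 1 (of_nat p)" if "j \<le> n" for j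
    using that
  proof (induction j)
    case (Suc j)
    \<comment> \<open>With \<open>p \<ge> 3\<close> this puts \<open>2 * j + 1\<close> below
      \<open>p ^ Suc r\<close>, so \<open>n / (2 * j + 1)\<close> is p-integral.\<close>
    have "2 * j + 1 < 3 * n" using Suc.prems by simp
    also have "\<dots> \<le> p ^ Suc r" using p3 by (simp add: n_def)
    finally have z: "of_nat n / of_nat (2 * j + 1) \<in> padic_integral p"
      unfolding n_def using assms(1) by (intro prime_power_div_padic_integral) auto
    let ?z = "of_nat n / of_nat (2 * j + 1) :: rat"
    have "1 - of_nat q / of_nat (2 * j + 1) = 1 - of_nat p * ?z" by (simp add: q_def)
    moreover have "padic_cong p (1 - of_nat p * ?z) 1 (of_nat p)"
      using z by (intro padic_congI[of _ _ _ "- ?z"] padic_integral_diff padic_integral_mult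
          padic_integral_uminus) simp_all
    ultimately have "padic_cong p ((\<Prod>i<j. 1 - of_nat q / of_nat (2 * i + 1)) *
        (1 - of_nat q / of_nat (2 * j + 1))) (1 * 1) (of_nat p)"
      using Suc by (intro padic_cong_mult) auto
    then show ?case by simp
  qed (simp add: padic_cong_refl)
  \<comment> \<open>The two indices differ by a multiple of \<open>n = p ^ r\<close>, which does not
    affect the coefficient modulo \<open>p\<close>.\<close>
  have "m = (p - 1) div 2 * n + (n - 1) div 2"
    using odd_n assms(2) by (auto simp: m_def q_def algebra_simps elim!: oddE)
  then have mk: "[m choose k = ((n - 1) div 2) choose k] (mod p)"
    using choose_add_mult_prime_power_cong[OF assms(1,3)] by (simp add: n_def)
  have four: "(- 4) ^ k \<in> padic_integral p"
    using padic_integral_of_int[of "(- 4) ^ k" p] by simp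
  have "padic_cong p (of_nat ((2 * k) choose k) * (\<Prod>i<k. 1 - of_nat q / of_nat (2 * i + 1)))
      (of_nat ((2 * k) choose k) * 1) (of_nat p)"
    using assms(3) by (intro padic_cong_mult padic_cong_refl prod) (auto simp: n_def)
  then have "padic_cong p (of_nat ((2 * k) choose k)) (of_nat (m choose k) * (- 4) ^ k) (of_nat p)"
    unfolding choose_half_eq_central_choose[OF qm] by (simp add: padic_cong_sym)
  moreover have "padic_cong p (of_nat (m choose k) * (- 4) ^ k)
      (of_nat (((n - 1) div 2) choose k) * (- 4) ^ k) (of_nat p)"
    using mk four by (intro padic_cong_mult padic_cong_refl padic_cong_of_nat)
  ultimately show ?thesis unfolding n_def by (rule padic_cong_trans)
qed

lemma sum_central_choose_squares_padic_cong:
  fixes p r :: nat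
  assumes "prime p" "[p = 1] (mod 4)"
  shows "padic_cong p (\<Sum>k<p ^ r. (of_nat ((2 * k) choose k) / 4 ^ k)\<^sup>2) 1 (of_nat p)"
proof -
  define n where "n = p ^ r"
  define m where "m = (n - 1) div 2"
  \<comment> \<open>The residue 1 modulo 4 passes from \<open>p\<close> to \<open>n\<close> and
    makes \<open>m\<close> even, so that the final sign \<open>(- 1) ^ m\<close> is 1.\<close>
  have "[n = 1 ^ r] (mod 4)" unfolding n_def using assms(2) by (rule cong_pow)
  then have "n mod 4 = 1" by (simp add: cong_def)
  then obtain t where "n = 4 * t + 1" by (metis mult_div_mod_eq)
  then have nm: "n = 2 * m + 1" "even m" by (auto simp: m_def)
  have "p mod 4 = 1" using assms(2) by (simp add: cong_def)
  then have odd_p: "odd p" by presburger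
  have four: "inverse (4 ^ k) \<in> padic_integral p" for k
    using padic_integral_inverse_of_nat[of "4 ^ k" p] odd_p coprime_power_left_iff[of 2 "2 * k" p]
    by (auto simp: power_mult)
  have "padic_cong p ((of_nat ((2 * k) choose k) / 4 ^ k)\<^sup>2) (of_nat ((m choose k)\<^sup>2)) (of_nat p)"
    if "k < n" for k
  proof -
    have "padic_cong p (of_nat ((2 * k) choose k)) (of_nat (m choose k) * (- 4) ^ k) (of_nat p)"
      using central_choose_padic_cong[OF assms(1) odd_p] that by (simp add: n_def m_def)
    then have "padic_cong p ((of_nat ((2 * k) choose k) * inverse (4 ^ k))\<^sup>2)
        ((of_nat (m choose k) * (- 4) ^ k * inverse (4 ^ k))\<^sup>2) (of_nat p)"
      by (intro padic_cong_power padic_cong_mult padic_cong_refl four)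
    \<comment> \<open>The sign \<open>(- 1) ^ k\<close> left here disappears on squaring.\<close>
    also have "of_nat (m choose k) * (- 4) ^ k * inverse (4 ^ k) = (of_nat (m choose k) * (- 1) ^ k :: rat)"
      by (simp add: power_minus[of 4] mult.assoc)
    finally show ?thesis by (simp add: divide_inverse power_mult_distrib flip: power_mult)
  qed
  then have "padic_cong p (\<Sum>k<n. (of_nat ((2 * k) choose k) / 4 ^ k)\<^sup>2)
      (\<Sum>k<n. of_nat ((m choose k)\<^sup>2)) (of_nat p)"
    by (intro padic_cong_sum) auto
  \<comment> \<open>Terms with \<open>k > m\<close> vanish, so the range shrinks to the full row
    \<open>m\<close>, whose squares sum to \<open>2 * m choose m\<close> with
    \<open>2 * m = n - 1\<close>.\<close>
  also have "(\<Sum>k<n. of_nat ((m choose k)\<^sup>2) :: rat) = of_nat (\<Sum>k\<le>m. (m choose k)\<^sup>2)"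
    unfolding of_nat_sum using nm by (intro sum.mono_neutral_right) auto
  also have "\<dots> = of_int (int ((n - 1) choose m))"
    unfolding choose_square_sum using nm by simp
  finally have "padic_cong p (\<Sum>k<n. (of_nat ((2 * k) choose k) / 4 ^ k)\<^sup>2)
      (of_int (int ((n - 1) choose m))) (of_nat p)" .
  moreover have "[int ((n - 1) choose m) = (- 1) ^ m] (mod int p)"
    unfolding n_def using nm by (intro choose_prime_power_minus_1_cong assms) (auto simp: n_def)
  then have "padic_cong p (of_int (int ((n - 1) choose m))) 1 (of_nat p)"
    using padic_cong_of_int[of "int ((n - 1) choose m)" 1 "int p" p] nm by simp
  ultimately show ?thesis unfolding n_def by (rule padic_cong_trans)
qed

section \<open>Telescoping of the weighted sum and assembly of the congruence\<close>

lemma sum_pochhammer_half_telescope: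
  "(\<Sum>k<n. (of_nat k + 1 / 4) * ((pochhammer (1 / 2) k)\<^sup>2 / (fact k)\<^sup>2)) =
    ((of_nat n)\<^sup>2 * ((pochhammer (1 / 2) n)\<^sup>2 / (fact n)\<^sup>2) :: 'a::field_char_0)"
proof (induction n)
  case (Suc n)
  have "(1 + of_nat n :: 'a) \<noteq> 0" by (metis of_nat_Suc of_nat_neq_0)
  \<comment> \<open>The factor \<open>(n + 1)\<^sup>2\<close> cancels the new denominator; expanding
    \<open>(n + 1 / 2)\<^sup>2\<close> as \<open>n\<^sup>2 + (n + 1 / 4)\<close> then gives the old
    value plus the new summand.\<close>
  then have "(of_nat (Suc n))\<^sup>2 * ((pochhammer (1 / 2) (Suc n))\<^sup>2 / (fact (Suc n))\<^sup>2) =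
      (1 / 2 + of_nat n)\<^sup>2 * ((pochhammer (1 / 2) n)\<^sup>2 / (fact n)\<^sup>2 :: 'a)"
    by (simp add: pochhammer_Suc power_mult_distrib)
  also have "(1 / 2 + of_nat n)\<^sup>2 = ((of_nat n)\<^sup>2 + (of_nat n + 1 / 4) :: 'a)"
    by (simp add: power2_eq_square algebra_simps)
  finally show ?case using Suc by (simp only: sum.lessThan_Suc distrib_right)
qed simp

theorem theorem1p2:
  fixes p r :: nat
  assumes "prime p" and "[p = 1] (mod 4)" and "r \<ge> 1"
  shows "padic_cong p
    (\<Sum>k = 0..p ^ r - 1.
       (of_nat k - (of_nat p ^ (2 * r) - 1) / 4) * ((pochhammer (1 / 2) k)\<^sup>2 / (fact k)\<^sup>2))
    0 (of_nat p ^ (2 * r + 1))"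
proof -
  define n where "n = p ^ r"
  define u :: "nat \<Rightarrow> rat" where "u k = (pochhammer (1 / 2) k)\<^sup>2 / (fact k)\<^sup>2" for k
  have u_eq: "u k = (of_nat ((2 * k) choose k) / 4 ^ k)\<^sup>2" for k
    by (simp add: u_def pochhammer_half_over_fact flip: power_divide)
  have n: "n > 0" using assms(1) by (simp add: n_def prime_gt_0_nat)
  have "p mod 4 = 1" using assms(2) by (simp add: cong_def)
  then have "odd p" by presburger
  then have coprime_4: "coprime (4 ^ k) p" for k
    using coprime_power_left_iff[of 2 "2 * k" p] by (auto simp: power_mult)
  have "\<not> p dvd 4"
    using coprime_4[of 1] assms(1) by (auto simp: coprime_absorb_right)
  \<comment> \<open>Together with the central coefficient being 2 modulo \<open>p\<close>, this
    yields \<open>u n\<close> \<equiv> (2/4)^2 = 1/4.\<close>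
  then have "[4 ^ n = 4] (mod p)"
    unfolding n_def using assms(1) by (intro power_prime_power_cong)
  then have "padic_cong p (inverse (of_nat (4 ^ n))) (inverse (of_nat 4)) (of_nat p)"
    using coprime_4[of n] coprime_4[of 1] by (intro padic_cong_inverse_of_nat) auto
  moreover have "padic_cong p (of_nat ((2 * n) choose n)) (of_nat 2) (of_nat p)"
    unfolding n_def by (intro padic_cong_of_nat central_choose_prime_power_cong assms)
  ultimately have "padic_cong p ((of_nat ((2 * n) choose n) * inverse (of_nat (4 ^ n)))\<^sup>2)
      ((of_nat 2 * inverse (of_nat 4))\<^sup>2) (of_nat p)"
    by (intro padic_cong_power padic_cong_mult)
  moreover have "(of_nat 2 * inverse (of_nat 4))\<^sup>2 = (1 / 4 :: rat)"
    by (simp add: power2_eq_square)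
  moreover have "u n = (of_nat ((2 * n) choose n) * inverse (of_nat (4 ^ n)))\<^sup>2"
    by (simp only: u_eq divide_inverse of_nat_power of_nat_numeral)
  ultimately have un: "padic_cong p (u n) (1 / 4) (of_nat p)" by metis
  have "padic_cong p (sum u {..<n}) 1 (of_nat p)"
    using sum_central_choose_squares_padic_cong[OF assms(1,2)] by (simp add: u_eq n_def)
  moreover have quarter: "- inverse 4 \<in> padic_integral p"
    using padic_integral_inverse_of_nat[of 4 p] coprime_4[of 1] by (auto intro: padic_integral_uminus)
  \<comment> \<open>The two quarters cancel, which supplies the one factor \<open>p\<close> needed
    beyond \<open>n\<^sup>2\<close>.\<close>
  ultimately have "padic_cong p (u n + sum u {..<n} * (- inverse 4)) (1 / 4 + 1 * (- inverse 4)) (of_nat p)"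
    by (intro padic_cong_add padic_cong_mult padic_cong_refl un)
  then obtain z where "z \<in> padic_integral p"
    "u n + sum u {..<n} * (- inverse 4) = (1 / 4 + 1 * (- inverse 4)) + of_nat p * z"
    by (rule padic_congE)
  then have z: "z \<in> padic_integral p" "u n - sum u {..<n} / 4 = of_nat p * z"
    by simp_all
  have pn: "of_nat p ^ (2 * r) = ((of_nat n)\<^sup>2 :: rat)"
    by (simp add: n_def mult.commute flip: power_mult)
  \<comment> \<open>Split the weight as \<open>(k + 1 / 4) - n\<^sup>2 / 4\<close>: the first part
    telescopes, and both parts then carry the factor \<open>n\<^sup>2 = p ^ (2 * r)\<close>.\<close>
  have "(\<Sum>k = 0..n - 1. (of_nat k - (of_nat p ^ (2 * r) - 1) / 4) * u k) =
      (\<Sum>k<n. (of_nat k + 1 / 4) * u k - (of_nat n)\<^sup>2 / 4 * u k)"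
    unfolding pn using n by (intro sum.cong) (auto simp: algebra_simps diff_divide_distrib)
  also have "\<dots> = (\<Sum>k<n. (of_nat k + 1 / 4) * u k) - (of_nat n)\<^sup>2 / 4 * sum u {..<n}"
    by (simp add: sum_subtractf sum_distrib_left)
  also have "(\<Sum>k<n. (of_nat k + 1 / 4) * u k) = (of_nat n)\<^sup>2 * u n"
    unfolding u_def by (rule sum_pochhammer_half_telescope)
  also have "(of_nat n)\<^sup>2 * u n - (of_nat n)\<^sup>2 / 4 * sum u {..<n} = (of_nat n)\<^sup>2 * (of_nat p * z)"
    unfolding z(2)[symmetric] by (simp add: algebra_simps)
  also have "\<dots> = of_nat p ^ (2 * r + 1) * z"
    by (simp add: pn)
  finally have "(\<Sum>k = 0..n - 1. (of_nat k - (of_nat p ^ (2 * r) - 1) / 4) * u k) =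
      of_nat p ^ (2 * r + 1) * z" .
  \<comment> \<open>\<open>padic_cong\<close> also demands that the sum itself be p-integral; this
    is read off from its factored form.\<close>
  moreover have "of_nat p ^ (2 * r + 1) * z \<in> padic_integral p"
    using z(1) padic_integral_of_nat[of "p ^ (2 * r + 1)" p]
    by (metis of_nat_power padic_integral_mult)
  ultimately show ?thesis
    unfolding n_def u_def using z(1) by (intro padic_congI[of _ _ _ z]) simp_all
qed

end
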